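(* Let $G:\mathbb{R}^p\to\mathbb{R}^p$ be a single-valued maximally monotone operator that is $L$-Lipschitz continuous with $L>0$, and let $x^\star$ be a solution of $G(x^\star)=0$ (the solution set is assumed nonempty). Let $x_0\in\mathbb{R}^p$, set $y_{-1}:=x_0$, and for $k\ge 0$ let $$y_k := \beta_k x_0+(1-\beta_k)x_k-\eta_k G(y_{k-1}),\qquad x_{k+1}:=\beta_k x_0+(1-\beta_k)x_k-\eta_k G(y_k),$$ where, with $M:=4L^2$ and $0<\eta_0\le \frac{1}{2L\sqrt{3}}$, $$\beta_k:=\frac{1}{k+2},\qquad \eta_{k+1}:=\frac{(1-\beta_k^2-M\eta_k^2)\,\beta_{k+1}\eta_k}{(1-M\eta_k^2)(1-\beta_k)\beta_k}.$$ Then $\eta_*:=\lim_{k\to\infty}\eta_k$ exists and $\eta_*>\underline{\eta}:=\frac{\eta_0(1-2M\eta_0^2)}{1-M\eta_0^2}>0$. Moreover, for all $k\ge 0$, $$\|G(x_k)\|^2+2L^2\|x_k-y_{k-1}\|^2\le \frac{4}{\eta_*(k+1)(k+2)}\left[\eta_0\|G(x_0)\|^2+\frac{1}{\eta_*}\|x_0-x^\star\|^2\right].$$ Consequently, with $C_*:=\frac{4(\eta_0\eta_*L^2+1)}{\eta_*^2}$, for all $k\geq 0$, $$\|G(x_k)\|^2\le\frac{C_*\|x_0-x^\star\|^2}{(k+1)(k+2)},\qquad \|x_k-y_{k-1}\|^2\le\frac{C_*\|x_0-x^\star\|^2}{2L^2(k+1)(k+2)},$$ $$\|G(y_k)-G(y_{k-1})\|^2\le\frac{C_*\|x_0-x^\star\|^2}{2L^2\eta_*^2(k+2)(k+3)}.$$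 Hence both $\|G(x_k)\|$ and $\|x_{k+1}-y_k\|$ converge to zero at the rate $\mathcal{O}(1/k)$.
   Context: $\mathbb{R}^p$ carries the standard inner product $\langle\cdot,\cdot\rangle$ and Euclidean norm $\|\cdot\|$. A single-valued $G$ is monotone if $\langle G(x)-G(y),x-y\rangle\ge 0$ for all $x,y$, and maximally monotone if its graph is not properly contained in the graph of another monotone operator. $G$ is $L$-Lipschitz continuous if $\|G(x)-G(y)\|\le L\|x-y\|$ for all $x,y$. *)

theory Defs
  imports "HOL-Analysis.Analysis" "HOL-Library.Landau_Symbols"
begin

text \<open>Set-valued operators on a real inner product space are identified with their graphs.\<close>

definition monotone_operator :: "('a::real_inner \<times> 'a) set \<Rightarrow> bool" where
  "monotone_operator A \<longleftrightarrow> (\<forall>(x, u) \<in> A. \<forall>(y, v) \<in> A. inner (u - v) (x - y) \<ge> 0)"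

definition maximally_monotone_operator :: "('a::real_inner \<times> 'a) set \<Rightarrow> bool" where
  "maximally_monotone_operator A \<longleftrightarrow>
     monotone_operator A \<and> \<not> (\<exists>B. monotone_operator B \<and> A \<subset> B)"

definition operator_graph :: "('a \<Rightarrow> 'b) \<Rightarrow> ('a \<times> 'b) set" where
  "operator_graph G = {(x, G x) | x. True}"

end

theory Submission
  imports Defs
begin

text \<open>
  The proof is a Lyapunov argument. The potential
  \<open>V k = \<eta> k (k+1) (k+2) / 2 \<cdot> (|G (x k)|\<^sup>2 + L\<^sup>2 |x k - y (k-1)|\<^sup>2) + (k+1) \<langle>G (x k), x k - x0\<rangle>\<close>
  is nonincreasing: monotonicity of \<open>G\<close> between consecutive iterates controls the inner product,
  Lipschitz continuity controls the discrepancy between \<open>G (x (k+1))\<close> and \<open>G (y k)\<close>, and the update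
  of \<open>\<eta>\<close> is exactly what balances the remaining Young inequality. Since \<open>\<langle>G (x k), x k - xstar\<rangle> \<ge> 0\<close>,
  the inner product in \<open>V k\<close> costs at most half of the term \<open>|G (x k)|\<^sup>2\<close>, and \<open>V k \<le> V 0\<close> gives the
  rate. The step sizes satisfy
  \<open>\<eta> (k+1) = \<eta> k (1 - m\<^sub>k / ((1 - m\<^sub>k) (k+1) (k+3)))\<close> with \<open>m\<^sub>k = M (\<eta> k)\<^sup>2\<close>, so they decrease, with a
  total decrease controlled by \<open>(\<Sum>k. 1 / ((k+1) (k+3))) = 3/4 < 1\<close>.
\<close>

section \<open>The step sizes\<close>

text \<open>The identity \<open>(t + 2)^2 = (t + 1) * (t + 3) + 1\<close> turns the update into a
  perturbation of the constant step: for \<open>t = k\<close> the ratio of successive step sizes is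
  one minus a loss that is summable as long as \<open>m / (1 - m)\<close> stays bounded.\<close>

lemma halpern_stepsize_factor:
  fixes m t :: real
  assumes "0 \<le> t" "m < 1"
  defines "b \<equiv> 1 / (t + 2)"
  shows "(1 - b\<^sup>2 - m) * (1 / (t + 3)) / ((1 - m) * (1 - b) * b)
           = 1 - m / (1 - m) * (1 / ((t + 1) * (t + 3)))"
proof -
  have ne: "t + 1 \<noteq> 0" "t + 2 \<noteq> 0" "t + 3 \<noteq> 0" "1 - m \<noteq> 0"
    using assms by auto
  have "1 - b = (t + 1) / (t + 2)"
    using ne by (simp add: b_def field_simps)
  moreover have "1 - b\<^sup>2 = (t + 1) * (t + 3) / (t + 2)\<^sup>2"
    using ne by (simp add: b_def power_divide divide_simps) (simp add: power2_eq_square algebra_simps)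
  ultimately have "(1 - b\<^sup>2 - m) * (1 / (t + 3)) / ((1 - m) * (1 - b) * b)
      = ((t + 1) * (t + 3) / (t + 2)\<^sup>2 - m) * (1 / (t + 3)) / ((1 - m) * ((t + 1) / (t + 2)) * (1 / (t + 2)))"
    by (simp add: b_def)
  also have "\<dots> = ((t + 1) * (t + 3) - m * (t + 2)\<^sup>2) / ((1 - m) * (t + 1) * (t + 3))"
    using ne by (simp add: divide_simps power2_eq_square)
  also have "\<dots> = ((1 - m) * (t + 1) * (t + 3) - m) / ((1 - m) * (t + 1) * (t + 3))"
    by (simp add: algebra_simps power2_eq_square)
  also have "\<dots> = 1 - m / (1 - m) * (1 / ((t + 1) * (t + 3)))"
    using ne by (simp add: diff_divide_distrib)
  finally show ?thesis .
qed

text \<open>As the step sizes never exceed \<open>\<eta> 0\<close>, the constant \<open>r\<close>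
  bounds every quotient \<open>m / (1 - m)\<close>, so step \<open>k\<close> loses at most
  \<open>\<eta> 0 * r * q k\<close>. These losses telescope, and a decreasing sequence bounded below
  converges.\<close>

lemma halpern_stepsize_limit:
  fixes \<eta> :: "nat \<Rightarrow> real" and M :: real
  assumes M: "M > 0"
    and pos0: "0 < \<eta> 0"
    and small: "M * (\<eta> 0)\<^sup>2 \<le> 1 / 3"
    and rec: "\<And>k. M * (\<eta> k)\<^sup>2 < 1 \<Longrightarrow> \<eta> (Suc k) = \<eta> k *
        (1 - M * (\<eta> k)\<^sup>2 / (1 - M * (\<eta> k)\<^sup>2) * (1 / ((real k + 1) * (real k + 3))))"
  defines "r \<equiv> M * (\<eta> 0)\<^sup>2 / (1 - M * (\<eta> 0)\<^sup>2)"
  obtains \<eta>s where "\<eta> \<longlonglongrightarrow> \<eta>s" "\<eta> 0 * (1 - 3 / 4 * r) \<le> \<eta>s"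
    "\<And>k. \<eta>s \<le> \<eta> k" "\<And>k. \<eta> k \<le> \<eta> 0"
proof -
  define q where "q k = 1 / ((real k + 1) * (real k + 3))" for k
  \<comment> \<open>By partial fractions \<open>p k\<close> is the sum of \<open>q j\<close> over
    \<open>j >= k\<close>. Since \<open>p 0 = 3 / 4\<close>, the difference
    \<open>3 / 4 - p k\<close> is the sum of \<open>q\<close> over the indices before
    \<open>k\<close>.\<close>
  define p where "p k = 1 / 2 * (1 / (real k + 1) + 1 / (real k + 2))" for k
  have p_Suc: "p (Suc k) = p k - q k" for k
    unfolding p_def q_def by (simp add: divide_simps) (simp add: algebra_simps)
  have p_pos: "0 < p k" for k
    unfolding p_def by (intro mult_pos_pos add_pos_pos) auto
  have r: "0 \<le> r" "r \<le> 1 / 2"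
    using M small unfolding r_def by (auto simp: divide_simps)
  have main: "0 < \<eta> k \<and> \<eta> k \<le> \<eta> 0 \<and> \<eta> 0 * (1 - r * (3 / 4 - p k)) \<le> \<eta> k \<and> \<eta> (Suc k) \<le> \<eta> k" for k
  proof -
    have step: "0 < \<eta> (Suc k) \<and> \<eta> (Suc k) \<le> \<eta> k \<and> \<eta> k - \<eta> 0 * r * q k \<le> \<eta> (Suc k)"
      if pk: "0 < \<eta> k" and lk: "\<eta> k \<le> \<eta> 0" for k
    proof -
      define m where "m = M * (\<eta> k)\<^sup>2"
      have "m \<le> M * (\<eta> 0)\<^sup>2"
        unfolding m_def using M pk lk by (intro mult_left_mono power_mono) auto
      moreover from this have "m < 1" using small by linarith
      moreover have "0 \<le> m" using M by (simp add: m_def)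
      ultimately have m: "0 \<le> m" "m \<le> M * (\<eta> 0)\<^sup>2" "m < 1" by blast+
      have mr: "0 \<le> m / (1 - m)" "m / (1 - m) \<le> r"
        using m small unfolding r_def by (auto intro!: frac_le)
      have "1 * 3 \<le> (real k + 1) * (real k + 3)"
        by (intro mult_mono) auto
      then have q: "0 < q k" "q k \<le> 1 / 3"
        unfolding q_def by (auto intro: divide_left_mono)
      have e: "\<eta> (Suc k) = \<eta> k * (1 - m / (1 - m) * q k)"
        using rec[of k] m(3) unfolding m_def q_def by simp
      have a: "m / (1 - m) * q k \<le> r * q k"
        using mr q by (intro mult_right_mono) auto
      \<comment> \<open>The factor in the recursion is therefore at least \<open>5 / 6\<close>,
        which keeps the step size positive.\<close>
      have b: "r * q k \<le> 1 / 2 * (1 / 3)"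
        using r q by (intro mult_mono) auto
      have c: "0 \<le> m / (1 - m) * q k"
        using mr q by (intro mult_nonneg_nonneg) auto
      have "\<eta> k * (m / (1 - m) * q k) \<le> \<eta> 0 * (r * q k)"
        by (rule mult_mono[OF lk a]) (use pos0 c in linarith)+
      moreover have "0 < \<eta> (Suc k)"
        unfolding e using a b pk by (intro mult_pos_pos) auto
      moreover have "0 \<le> \<eta> k * (m / (1 - m) * q k)"
        by (rule mult_nonneg_nonneg[OF less_imp_le[OF pk] c])
      ultimately show ?thesis
        unfolding e by (simp add: right_diff_distrib mult.assoc)
    qed
    have "0 < \<eta> k \<and> \<eta> k \<le> \<eta> 0 \<and> \<eta> 0 * (1 - r * (3 / 4 - p k)) \<le> \<eta> k"
    proof (induction k)
      case 0
      then show ?case using pos0 by (simp add: p_def)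
    next
      case (Suc k)
      have "\<eta> 0 * (1 - r * (3 / 4 - p (Suc k))) = \<eta> 0 * (1 - r * (3 / 4 - p k)) - \<eta> 0 * r * q k"
        unfolding p_Suc by (simp add: algebra_simps)
      then show ?case using step[of k] Suc by linarith
    qed
    with step[of k] show ?thesis by blast
  qed
  have lower: "\<eta> 0 * (1 - 3 / 4 * r) \<le> \<eta> k" for k
  proof -
    have "r * (3 / 4 - p k) \<le> r * (3 / 4)"
      using r p_pos[of k] by (intro mult_left_mono) auto
    then have "\<eta> 0 * (1 - 3 / 4 * r) \<le> \<eta> 0 * (1 - r * (3 / 4 - p k))"
      using pos0 by (intro mult_left_mono) auto
    with main[of k] show ?thesis by linarith
  qed
  have "decseq \<eta>"
    using main by (simp add: decseq_Suc_iff)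
  then obtain \<eta>s where lim: "\<eta> \<longlonglongrightarrow> \<eta>s" and "\<And>k. \<eta>s \<le> \<eta> k"
    using decseq_convergent lower by blast
  moreover have "\<eta> 0 * (1 - 3 / 4 * r) \<le> \<eta>s"
    using LIMSEQ_le_const[OF lim] lower by blast
  ultimately show thesis
    using that main by blast
qed

section \<open>Decrease of the potential\<close>

text \<open>
  Here \<open>u\<close>, \<open>v\<close>, \<open>w\<close> stand for \<open>G (x k)\<close>, \<open>G (x (k+1))\<close>, \<open>G (y k)\<close>, while \<open>n = k + 1\<close> and
  \<open>\<rho> = \<eta> (k+1) / \<eta> k\<close>.
\<close>
lemma halpern_potential_core:
  fixes u v w :: "'a::real_inner" and n m \<rho> D D' :: real
  assumes n: "1 \<le> n" and m: "0 < m" "m \<le> 1 / 3"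
    and rho: "\<rho> * (n + 2) = n + 2 - m / ((1 - m) * n)"
    and D': "D' \<le> m / 2 * ((norm (w - u))\<^sup>2 + D)"
    and vw: "(norm (v - w))\<^sup>2 \<le> D'"
  shows "\<rho> * (n + 2) * ((norm v)\<^sup>2 + D')
           \<le> n * ((norm u)\<^sup>2 + D) + 2 * (n + 1) * (v \<bullet> w) - 2 * n * (u \<bullet> w)"
proof -
  \<comment> \<open>\<open>e\<close> is the amount by which the coefficient
    \<open>\<rho> * (n + 2)\<close> falls short of \<open>n + 2\<close>. It also serves as the
    weight in Young's inequality for \<open>v\<close> and \<open>w - v\<close>, whose reciprocal is
    \<open>n / m - n\<close>.\<close>
  define e where "e = m / ((1 - m) * n)"
  have e: "0 < e" using m n by (simp add: e_def)
  have inv_e: "1 / e = n / m - n"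
    using m n by (simp add: e_def field_simps)
  have "0 \<le> (norm (e *\<^sub>R v + (w - v)))\<^sup>2 / e"
    using e by simp
  also have "\<dots> = e * (norm v)\<^sup>2 + 2 * (v \<bullet> (w - v)) + (1 / e) * (norm (v - w))\<^sup>2"
    using e unfolding power2_norm_eq_inner
    by (simp add: field_simps inner_simps inner_commute)
  finally have young: "0 \<le> e * (norm v)\<^sup>2 + 2 * (v \<bullet> (w - v)) + (n / m - n) * (norm (v - w))\<^sup>2"
    unfolding inv_e .
  have D'_nonneg: "0 \<le> D'" using vw by (smt (verit) zero_le_power2)
  \<comment> \<open>\<open>D\<close> is an arbitrary real here, so the sign of this sum is read off
    from \<open>0 \<le> D'\<close> and the upper bound on \<open>D'\<close>.\<close>
  have S: "0 \<le> (norm (w - u))\<^sup>2 + D"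
    using order_trans[OF D'_nonneg D'] m unfolding zero_le_mult_iff by linarith
  have "n / m * (norm (v - w))\<^sup>2 \<le> n / m * D'"
    using vw n m by (intro mult_left_mono) auto
  moreover have "\<rho> * (n + 2) * D' \<le> (n + 2) * D'"
    using D'_nonneg e rho unfolding e_def by (intro mult_right_mono) auto
  moreover have "(n / m + (n + 2)) * D' \<le> (n / m + (n + 2)) * (m / 2 * ((norm (w - u))\<^sup>2 + D))"
    using D' n m by (intro mult_left_mono) auto
  moreover have "(n / m + (n + 2)) * (m / 2 * ((norm (w - u))\<^sup>2 + D))
      \<le> n * ((norm (w - u))\<^sup>2 + D)"
  proof -
    \<comment> \<open>The bounds \<open>1 \<le> n\<close> and \<open>m \<le> 1 / 3\<close> give
      \<open>(n + 2) * m \<le> n\<close>, with equality at \<open>n = 1\<close>,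
      \<open>m = 1 / 3\<close>; this lets the single budget \<open>n\<close> pay for both error
      terms.\<close>
    have "(n + 2) * m \<le> (3 * n) * (1 / 3)"
      using n m by (intro mult_mono) auto
    moreover have "(n / m + (n + 2)) * (m / 2) = (n + (n + 2) * m) / 2"
      using m by (simp add: field_simps)
    ultimately have "(n / m + (n + 2)) * (m / 2) \<le> n"
      by simp
    from mult_right_mono[OF this S] show ?thesis by (simp add: mult.assoc)
  qed
  ultimately have bound: "n / m * (norm (v - w))\<^sup>2 + \<rho> * (n + 2) * D' \<le> n * ((norm (w - u))\<^sup>2 + D)"
    by (simp add: algebra_simps)
  \<comment> \<open>Completing the square in \<open>w - u\<close> isolates the Young expression. The
    remaining \<open>- n * (norm (v - w))^2\<close> turns the Young coefficient
    \<open>n / m - n\<close> into the \<open>n / m\<close> of \<open>bound\<close>.\<close>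
  have "n * ((norm u)\<^sup>2 + D) + 2 * (n + 1) * (v \<bullet> w) - 2 * n * (u \<bullet> w) - (n + 2 - e) * (norm v)\<^sup>2
      = n * ((norm (w - u))\<^sup>2 + D) + e * (norm v)\<^sup>2 + 2 * (v \<bullet> (w - v)) - n * (norm (v - w))\<^sup>2"
    unfolding power2_norm_eq_inner by (simp add: algebra_simps inner_simps inner_commute)
  with young bound show ?thesis
    unfolding rho e_def[symmetric] by (simp add: algebra_simps)
qed

text \<open>One step of the potential, with \<open>p\<close>, \<open>p'\<close>, \<open>q\<close>,
  \<open>r\<close>, \<open>a\<close> for \<open>x k\<close>, \<open>x (k+1)\<close>,
  \<open>y k\<close>, \<open>y (k-1)\<close>, \<open>x0\<close> and \<open>t\<close>,
  \<open>h\<close>, \<open>h'\<close> for \<open>k\<close>, \<open>\<eta> k\<close>,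
  \<open>\<eta> (k+1)\<close>. Monotonicity between \<open>p\<close> and \<open>p'\<close>
  eliminates \<open>p - a\<close>, leaving inner products of values of \<open>G\<close> that the
  core inequality handles.\<close>

lemma halpern_potential_step:
  fixes G :: "'a::real_inner \<Rightarrow> 'a" and p p' q r a :: 'a and t h h' L :: real
  assumes mono: "\<And>x y. 0 \<le> (G x - G y) \<bullet> (x - y)"
    and lip: "L-lipschitz_on UNIV G"
    and t: "0 \<le> t" and L: "0 < L" and h: "0 < h" "4 * L\<^sup>2 * h\<^sup>2 \<le> 1 / 3"
    and h': "h' = h * (1 - 4 * L\<^sup>2 * h\<^sup>2 / (1 - 4 * L\<^sup>2 * h\<^sup>2) * (1 / ((t + 1) * (t + 3))))"
    and q: "q = (1 / (t + 2)) *\<^sub>R a + (1 - 1 / (t + 2)) *\<^sub>R p - h *\<^sub>R G r"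
    and p': "p' = (1 / (t + 2)) *\<^sub>R a + (1 - 1 / (t + 2)) *\<^sub>R p - h *\<^sub>R G q"
  shows "h' * (t + 2) * (t + 3) / 2 * ((norm (G p'))\<^sup>2 + L\<^sup>2 * (norm (p' - q))\<^sup>2) + (t + 2) * (G p' \<bullet> (p' - a))
       \<le> h * (t + 1) * (t + 2) / 2 * ((norm (G p))\<^sup>2 + L\<^sup>2 * (norm (p - r))\<^sup>2) + (t + 1) * (G p \<bullet> (p - a))"
proof -
  define m where "m = 4 * L\<^sup>2 * h\<^sup>2"
  define D where "D = L\<^sup>2 * (norm (p - r))\<^sup>2"
  define D' where "D' = L\<^sup>2 * (norm (p' - q))\<^sup>2"
  define \<rho> where "\<rho> = h' / h"
  have lip2: "(norm (G z - G z'))\<^sup>2 \<le> L\<^sup>2 * (norm (z - z'))\<^sup>2" for z z'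
    using power_mono[OF lipschitz_onD[OF lip, of z z'], of 2]
    by (simp add: dist_norm power_mult_distrib)
  have m: "0 < m" "m \<le> 1 / 3"
    using L h by (auto simp: m_def)
  have rho: "\<rho> * ((t + 1) + 2) = (t + 1) + 2 - m / ((1 - m) * (t + 1))"
  proof -
    have "\<rho> = 1 - m / (1 - m) * (1 / ((t + 1) * (t + 3)))"
      unfolding \<rho>_def h' m_def using h by simp
    then have "\<rho> * (t + 3) = t + 3 - m / (1 - m) * (1 / ((t + 1) * (t + 3)) * (t + 3))"
      by (simp only: left_diff_distrib mult.assoc mult_1_left)
    also have "1 / ((t + 1) * (t + 3)) * (t + 3) = 1 / (t + 1)"
      using t by simp
    finally show ?thesis
      by (simp add: add.assoc)
  qed
  have p'q: "p' - q = h *\<^sub>R (G r - G q)"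
    unfolding p' by (subst q) (simp add: algebra_simps)
  \<comment> \<open>Passing from \<open>G r\<close> to \<open>G q\<close> through \<open>G p\<close>
    costs a factor 2 on squared norms, and \<open>2 * L^2 * h^2 = m / 2\<close>. This is the origin
    of the constant 4 in \<open>M\<close>.\<close>
  have D': "D' \<le> m / 2 * ((norm (G q - G p))\<^sup>2 + D)"
  proof -
    have "(norm (G r - G q))\<^sup>2 \<le> 2 * (norm (G q - G p))\<^sup>2 + 2 * (norm (G p - G r))\<^sup>2"
    proof -
      have "0 \<le> (norm ((G q - G p) - (G p - G r)))\<^sup>2" by simp
      then show ?thesis
        unfolding power2_norm_eq_inner by (simp add: algebra_simps inner_simps inner_commute)
    qed
    also have "\<dots> \<le> 2 * ((norm (G q - G p))\<^sup>2 + D)"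
      using lip2[of p r] unfolding D_def by simp
    finally have "L\<^sup>2 * h\<^sup>2 * (norm (G r - G q))\<^sup>2 \<le> L\<^sup>2 * h\<^sup>2 * (2 * ((norm (G q - G p))\<^sup>2 + D))"
      by (intro mult_left_mono) auto
    moreover have "D' = L\<^sup>2 * h\<^sup>2 * (norm (G r - G q))\<^sup>2"
      unfolding D'_def p'q by (simp add: power_mult_distrib)
    ultimately show ?thesis
      unfolding m_def by (simp add: algebra_simps)
  qed
  have vw: "(norm (G p' - G q))\<^sup>2 \<le> D'"
    unfolding D'_def by (rule lip2)
  have core: "\<rho> * ((t + 1) + 2) * ((norm (G p'))\<^sup>2 + D')
      \<le> (t + 1) * ((norm (G p))\<^sup>2 + D) + 2 * ((t + 1) + 1) * (G p' \<bullet> G q) - 2 * (t + 1) * (G p \<bullet> G q)"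
    by (rule halpern_potential_core[OF _ m rho D' vw]) (use t in auto)
  have dp: "(t + 2) *\<^sub>R (p' - a) = (t + 1) *\<^sub>R (p - a) - (h * (t + 2)) *\<^sub>R G q"
  proof -
    have "(t + 2) *\<^sub>R p' = a + (t + 1) *\<^sub>R p - (h * (t + 2)) *\<^sub>R G q"
      using t by (simp add: p' scaleR_diff_right scaleR_add_right right_diff_distrib mult.commute)
    then show ?thesis by (simp add: algebra_simps scaleR_2)
  qed
  \<comment> \<open>Like \<open>dp\<close>, this expresses a displacement through
    \<open>p - a\<close> and \<open>G q\<close> only, so that monotonicity bounds exactly the term
    in \<open>p - a\<close> that \<open>dp\<close> produces.\<close>
  have dp2: "(t + 2) *\<^sub>R (p' - p) = - ((p - a) + (h * (t + 2)) *\<^sub>R G q)"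
  proof -
    have "(t + 2) *\<^sub>R (p' - p) = (t + 2) *\<^sub>R (p' - a) - (t + 2) *\<^sub>R (p - a)"
      by (simp add: scaleR_diff_right)
    also have "\<dots> = - ((p - a) + (h * (t + 2)) *\<^sub>R G q)"
      unfolding dp by (simp add: algebra_simps scaleR_2)
    finally show ?thesis .
  qed
  have "0 \<le> (t + 2) * ((G p' - G p) \<bullet> (p' - p))"
    using mono t by simp
  also have "\<dots> = (G p' - G p) \<bullet> (- ((p - a) + (h * (t + 2)) *\<^sub>R G q))"
    unfolding dp2[symmetric] by simp
  finally have mono': "(G p' - G p) \<bullet> (p - a) \<le> - (h * (t + 2)) * ((G p' - G p) \<bullet> G q)"
    by (simp add: inner_simps)
  have "(t + 2) * (G p' \<bullet> (p' - a)) = G p' \<bullet> ((t + 2) *\<^sub>R (p' - a))" by simp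
  also have "\<dots> = (t + 1) * (G p' \<bullet> (p - a)) - h * (t + 2) * (G p' \<bullet> G q)"
    unfolding dp by (simp add: inner_simps)
  finally have "(t + 2) * (G p' \<bullet> (p' - a)) - (t + 1) * (G p \<bullet> (p - a))
      = (t + 1) * ((G p' - G p) \<bullet> (p - a)) - h * (t + 2) * (G p' \<bullet> G q)"
    by (simp add: inner_diff_left algebra_simps)
  also have "\<dots> \<le> (t + 1) * (- (h * (t + 2)) * ((G p' - G p) \<bullet> G q)) - h * (t + 2) * (G p' \<bullet> G q)"
    using mult_left_mono[OF mono', of "t + 1"] t by simp
  \<comment> \<open>Written this way, the bound is minus \<open>h * (t + 2) / 2\<close> times the
    cross terms of \<open>core\<close> (with \<open>n = t + 1\<close>), so they cancel once
    \<open>core\<close> is scaled by that factor.\<close>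
  also have "\<dots> = - (h * (t + 2) / 2) * (2 * (t + 2) * (G p' \<bullet> G q) - 2 * (t + 1) * (G p \<bullet> G q))"
    by (simp add: inner_diff_left field_simps)
  finally have inner_part: "(t + 2) * (G p' \<bullet> (p' - a)) - (t + 1) * (G p \<bullet> (p - a))
      \<le> - (h * (t + 2) / 2) * (2 * (t + 2) * (G p' \<bullet> G q) - 2 * (t + 1) * (G p \<bullet> G q))" .
  have "h' = \<rho> * h" using h by (simp add: \<rho>_def)
  then have "h' * (t + 2) * (t + 3) / 2 * ((norm (G p'))\<^sup>2 + D')
      = h * (t + 2) / 2 * (\<rho> * (t + 3) * ((norm (G p'))\<^sup>2 + D'))"
    by simp
  also have "\<dots> \<le> h * (t + 2) / 2 * ((t + 1) * ((norm (G p))\<^sup>2 + D)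
      + (2 * (t + 2) * (G p' \<bullet> G q) - 2 * (t + 1) * (G p \<bullet> G q)))"
    using core h t by (intro mult_left_mono) (auto simp: add.commute add.left_commute)
  also have "\<dots> = h * (t + 1) * (t + 2) / 2 * ((norm (G p))\<^sup>2 + D)
      + h * (t + 2) / 2 * (2 * (t + 2) * (G p' \<bullet> G q) - 2 * (t + 1) * (G p \<bullet> G q))"
    by (simp add: field_simps)
  finally show ?thesis
    using inner_part unfolding D_def D'_def by linarith
qed

section \<open>Convergence rates\<close>

text \<open>Young's inequality lets \<open>g \<bullet> d\<close> consume half of the coefficient of
  \<open>(norm g)^2\<close> but none of that of \<open>E\<close>; this is why \<open>E\<close>
  reappears doubled. Replacing \<open>h\<close> by its lower bound \<open>hs\<close> makes the rate
  uniform in the index.\<close>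

lemma rate_from_potential_bound:
  fixes g d :: "'a::real_inner" and t h hs V E :: real
  assumes t: "0 \<le> t" and hs: "0 < hs" "hs \<le> h" and E: "0 \<le> E"
    and bound: "h * (t + 1) * (t + 2) / 2 * ((norm g)\<^sup>2 + E) + (t + 1) * (g \<bullet> d) \<le> V"
  shows "(norm g)\<^sup>2 + 2 * E \<le> 4 / (hs * (t + 1) * (t + 2)) * (V + 1 / hs * (norm d)\<^sup>2)"
proof -
  have ne: "t + 1 \<noteq> 0" "t + 2 \<noteq> 0" "hs \<noteq> 0"
    using t hs by auto
  have "0 \<le> (norm (hs *\<^sub>R (t + 2) *\<^sub>R g + 2 *\<^sub>R d))\<^sup>2" by simp
  also have "\<dots> = (hs * (t + 2))\<^sup>2 * (norm g)\<^sup>2 + 4 * (hs * (t + 2)) * (g \<bullet> d) + 4 * (norm d)\<^sup>2"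
    unfolding power2_norm_eq_inner
    by (simp add: inner_simps inner_commute power2_eq_square algebra_simps)
  finally have y: "0 \<le> (hs * (t + 2))\<^sup>2 * (norm g)\<^sup>2 + 4 * (hs * (t + 2)) * (g \<bullet> d) + 4 * (norm d)\<^sup>2" .
  have "(hs * (t + 2))\<^sup>2 * (norm g)\<^sup>2 + 4 * (hs * (t + 2)) * (g \<bullet> d) + 4 * (norm d)\<^sup>2
    = 4 * (hs * (t + 2)) / (t + 1) * (hs * (t + 1) * (t + 2) / 4 * (norm g)\<^sup>2 + (t + 1) * (g \<bullet> d)
         + (t + 1) / (t + 2) * (1 / hs * (norm d)\<^sup>2))"
    using ne by (simp add: divide_simps) (simp add: algebra_simps power2_eq_square)
  moreover have "0 < 4 * (hs * (t + 2)) / (t + 1)"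
    using t hs by simp
  ultimately have "0 \<le> hs * (t + 1) * (t + 2) / 4 * (norm g)\<^sup>2 + (t + 1) * (g \<bullet> d)
         + (t + 1) / (t + 2) * (1 / hs * (norm d)\<^sup>2)"
    using y zero_le_mult_iff linorder_not_le by metis
  moreover have "(t + 1) / (t + 2) * (1 / hs * (norm d)\<^sup>2) \<le> 1 * (1 / hs * (norm d)\<^sup>2)"
    using t hs by (intro mult_right_mono) auto
  moreover have "hs * (t + 1) * (t + 2) / 2 * ((norm g)\<^sup>2 + E) \<le> h * (t + 1) * (t + 2) / 2 * ((norm g)\<^sup>2 + E)"
    using t hs E by (intro mult_right_mono divide_right_mono) auto
  ultimately have "hs * (t + 1) * (t + 2) / 2 * ((norm g)\<^sup>2 + E) - hs * (t + 1) * (t + 2) / 4 * (norm g)\<^sup>2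
      \<le> V + 1 / hs * (norm d)\<^sup>2"
    using bound by linarith
  also have "hs * (t + 1) * (t + 2) / 2 * ((norm g)\<^sup>2 + E) - hs * (t + 1) * (t + 2) / 4 * (norm g)\<^sup>2
      = hs * (t + 1) * (t + 2) / 4 * ((norm g)\<^sup>2 + 2 * E)"
    by (simp add: field_simps)
  finally have "hs * (t + 1) * (t + 2) / 4 * ((norm g)\<^sup>2 + 2 * E) \<le> V + 1 / hs * (norm d)\<^sup>2" .
  moreover have "0 < hs * (t + 1) * (t + 2) / 4" using t hs by simp
  ultimately have "(norm g)\<^sup>2 + 2 * E \<le> (V + 1 / hs * (norm d)\<^sup>2) / (hs * (t + 1) * (t + 2) / 4)"
    by (subst pos_le_divide_eq) (simp_all only: mult.commute)
  then show ?thesis by (simp add: mult.commute)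
qed

lemma rate_from_square_bound:
  fixes f :: "nat \<Rightarrow> 'a::real_normed_vector"
  assumes "\<And>k. (norm (f k))\<^sup>2 \<le> K / ((real k + 1) * (real k + 2))"
  shows "(\<lambda>k. norm (f k)) \<longlonglongrightarrow> 0" "(\<lambda>k. norm (f k)) \<in> O(\<lambda>k. 1 / real k)"
proof -
  have "0 \<le> K / ((real 0 + 1) * (real 0 + 2))"
    using assms[of 0] order_trans zero_le_power2 by blast
  then have K: "0 \<le> K" by simp
  \<comment> \<open>Index 0 is excluded because \<open>1 / real 0 = 0\<close> in HOL.\<close>
  have le: "norm (f k) \<le> sqrt K * norm (1 / real k)" if "k > 0" for k
  proof (rule power2_le_imp_le)
    have "(norm (f k))\<^sup>2 \<le> K / ((real k + 1) * (real k + 2))" by (rule assms)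
    also have "\<dots> \<le> K / (real k)\<^sup>2"
      using K that by (intro divide_left_mono) (auto simp: power2_eq_square intro!: mult_mono)
    finally show "(norm (f k))\<^sup>2 \<le> (sqrt K * norm (1 / real k))\<^sup>2"
      using K by (simp add: power_mult_distrib power_divide)
  qed (use K in auto)
  show O: "(\<lambda>k. norm (f k)) \<in> O(\<lambda>k. 1 / real k)"
    by (rule bigoI[of _ "sqrt K"]) (use le in \<open>auto intro: eventually_sequentiallyI[of 1]\<close>)
  have "(\<lambda>k. sqrt K * (1 / real k)) \<longlonglongrightarrow> 0"
    by (intro tendsto_mult_right_zero lim_1_over_n)
  then show "(\<lambda>k. norm (f k)) \<longlonglongrightarrow> 0"
    by (rule Lim_null_comparison[rotated]) (use le in \<open>auto intro!: eventually_sequentiallyI[of 1]\<close>)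
qed

theorem theorem1:
  fixes G :: "real ^ 'p \<Rightarrow> real ^ 'p"
    and L M :: real
    and xstar x0 :: "real ^ 'p"
    and x :: "nat \<Rightarrow> real ^ 'p"
    and y :: "int \<Rightarrow> real ^ 'p"
    and \<beta> \<eta> :: "nat \<Rightarrow> real"
  assumes maximal: "maximally_monotone_operator (operator_graph G)"
    and L_pos: "L > 0"
    and lipschitz: "L-lipschitz_on UNIV G"
    and solution: "G xstar = 0"
    and M: "M = 4 * L\<^sup>2"
    and beta: "\<And>k. \<beta> k = 1 / (real k + 2)"
    and eta_0: "0 < \<eta> 0" "\<eta> 0 \<le> 1 / (2 * L * sqrt 3)"
    and eta_Suc: "\<And>k. \<eta> (Suc k) =
          (1 - (\<beta> k)\<^sup>2 - M * (\<eta> k)\<^sup>2) * \<beta> (Suc k) * \<eta> k /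
          ((1 - M * (\<eta> k)\<^sup>2) * (1 - \<beta> k) * \<beta> k)"
    and x_0: "x 0 = x0"
    and y_init: "y (- 1) = x0"
    and y_step: "\<And>k. y (int k) =
          \<beta> k *\<^sub>R x0 + (1 - \<beta> k) *\<^sub>R x k - \<eta> k *\<^sub>R G (y (int k - 1))"
    and x_step: "\<And>k. x (Suc k) =
          \<beta> k *\<^sub>R x0 + (1 - \<beta> k) *\<^sub>R x k - \<eta> k *\<^sub>R G (y (int k))"
  shows "\<exists>\<eta>s. \<eta> \<longlonglongrightarrow> \<eta>s \<and>
      \<eta>s > \<eta> 0 * (1 - 2 * M * (\<eta> 0)\<^sup>2) / (1 - M * (\<eta> 0)\<^sup>2) \<and>
      \<eta> 0 * (1 - 2 * M * (\<eta> 0)\<^sup>2) / (1 - M * (\<eta> 0)\<^sup>2) > 0 \<and>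
      (\<forall>k. (norm (G (x k)))\<^sup>2 + 2 * L\<^sup>2 * (norm (x k - y (int k - 1)))\<^sup>2
            \<le> 4 / (\<eta>s * (real k + 1) * (real k + 2)) *
               (\<eta> 0 * (norm (G x0))\<^sup>2 + 1 / \<eta>s * (norm (x0 - xstar))\<^sup>2)) \<and>
      (let C = 4 * (\<eta> 0 * \<eta>s * L\<^sup>2 + 1) / \<eta>s\<^sup>2 in
        (\<forall>k. (norm (G (x k)))\<^sup>2
              \<le> C * (norm (x0 - xstar))\<^sup>2 / ((real k + 1) * (real k + 2))) \<and>
        (\<forall>k. (norm (x k - y (int k - 1)))\<^sup>2
              \<le> C * (norm (x0 - xstar))\<^sup>2 / (2 * L\<^sup>2 * (real k + 1) * (real k + 2))) \<and>
        (\<forall>k. (norm (G (y (int k)) - G (y (int k - 1))))\<^sup>2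
              \<le> C * (norm (x0 - xstar))\<^sup>2 /
                 (2 * L\<^sup>2 * \<eta>s\<^sup>2 * (real k + 2) * (real k + 3)))) \<and>
      (\<lambda>k. norm (G (x k))) \<longlonglongrightarrow> 0 \<and>
      (\<lambda>k. norm (G (x k))) \<in> O(\<lambda>k. 1 / real k) \<and>
      (\<lambda>k. norm (x (Suc k) - y (int k))) \<longlonglongrightarrow> 0 \<and>
      (\<lambda>k. norm (x (Suc k) - y (int k))) \<in> O(\<lambda>k. 1 / real k)"
proof -
  have mono: "0 \<le> (G p - G q) \<bullet> (p - q)" for p q
    using maximal unfolding maximally_monotone_operator_def monotone_operator_def operator_graph_def
    by auto
  have M_pos: "M > 0" using L_pos M by simp
  have small: "M * (\<eta> 0)\<^sup>2 \<le> 1 / 3"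
  proof -
    have "(\<eta> 0)\<^sup>2 \<le> (1 / (2 * L * sqrt 3))\<^sup>2"
      using eta_0 by (intro power_mono) auto
    also have "\<dots> = 1 / 3 / M"
      using L_pos by (simp add: M power_divide power_mult_distrib)
    finally show ?thesis using M_pos by (simp add: field_simps)
  qed
  have eta_rec: "\<eta> (Suc k) = \<eta> k *
      (1 - M * (\<eta> k)\<^sup>2 / (1 - M * (\<eta> k)\<^sup>2) * (1 / ((real k + 1) * (real k + 3))))"
    if "M * (\<eta> k)\<^sup>2 < 1" for k
  proof -
    have "\<beta> (Suc k) = 1 / (real k + 3)" by (simp add: beta add.commute)
    then have "\<eta> (Suc k) = \<eta> k * ((1 - (1 / (real k + 2))\<^sup>2 - M * (\<eta> k)\<^sup>2) * (1 / (real k + 3)) /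
          ((1 - M * (\<eta> k)\<^sup>2) * (1 - 1 / (real k + 2)) * (1 / (real k + 2))))"
      unfolding eta_Suc by (simp add: beta mult_ac add.commute)
    then show ?thesis
      unfolding halpern_stepsize_factor[OF of_nat_0_le_iff that] .
  qed
  obtain \<eta>s where lim: "\<eta> \<longlonglongrightarrow> \<eta>s"
    and etas_ge: "\<eta> 0 * (1 - 3 / 4 * (M * (\<eta> 0)\<^sup>2 / (1 - M * (\<eta> 0)\<^sup>2))) \<le> \<eta>s"
    and etas_le: "\<And>k. \<eta>s \<le> \<eta> k" and eta_le: "\<And>k. \<eta> k \<le> \<eta> 0"
    using halpern_stepsize_limit[OF M_pos eta_0(1) small eta_rec] by blast
  define m where "m = M * (\<eta> 0)\<^sup>2"
  have m: "0 < m" "m \<le> 1 / 3"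
    using M_pos eta_0 small by (auto simp: m_def)
  have lower_pos: "\<eta> 0 * (1 - 2 * M * (\<eta> 0)\<^sup>2) / (1 - M * (\<eta> 0)\<^sup>2) > 0"
    using m eta_0 by (auto simp: m_def mult.assoc intro!: divide_pos_pos mult_pos_pos)
  \<comment> \<open>The claimed bound is \<open>\<eta> 0 * (1 - m / (1 - m))\<close>; the total loss
    factor \<open>3 / 4\<close> in place of 1, together with \<open>0 < m\<close>, makes it
    strict.\<close>
  have lower: "\<eta>s > \<eta> 0 * (1 - 2 * M * (\<eta> 0)\<^sup>2) / (1 - M * (\<eta> 0)\<^sup>2)"
  proof -
    have "(1 - 2 * m) / (1 - m) < 1 - 3 / 4 * (m / (1 - m))"
      using m by (simp add: field_simps)
    from mult_strict_left_mono[OF this eta_0(1)] etas_ge show ?thesis by (simp add: m_def mult.assoc)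
  qed
  have etas: "0 < \<eta>s" using lower lower_pos by linarith
  have eta_pos: "0 < \<eta> k" for k using etas etas_le[of k] by linarith
  have eta_small: "M * (\<eta> k)\<^sup>2 \<le> 1 / 3" for k
  proof -
    have "M * (\<eta> k)\<^sup>2 \<le> M * (\<eta> 0)\<^sup>2"
      using M_pos eta_pos[of k] eta_le by (intro mult_left_mono power_mono) auto
    with small show ?thesis by linarith
  qed

  define V where "V k = \<eta> k * (real k + 1) * (real k + 2) / 2 *
      ((norm (G (x k)))\<^sup>2 + L\<^sup>2 * (norm (x k - y (int k - 1)))\<^sup>2)
      + (real k + 1) * (G (x k) \<bullet> (x k - x0))" for k
  have "V (Suc k) \<le> V k" for k
  proof -
    have small': "4 * L\<^sup>2 * (\<eta> k)\<^sup>2 \<le> 1 / 3"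
      using eta_small[of k] by (simp add: M)
    then have rec': "\<eta> (Suc k) = \<eta> k * (1 - 4 * L\<^sup>2 * (\<eta> k)\<^sup>2 / (1 - 4 * L\<^sup>2 * (\<eta> k)\<^sup>2)
        * (1 / ((real k + 1) * (real k + 3))))"
      using eta_rec[of k] by (simp add: M)
    show ?thesis
      using halpern_potential_step[OF mono lipschitz of_nat_0_le_iff L_pos eta_pos small' rec'
          y_step[unfolded beta] x_step[unfolded beta]]
      unfolding V_def by (simp add: algebra_simps)
  qed
  then have V_le: "V k \<le> V 0" for k
    by (meson decseqD decseq_SucI zero_le)
  \<comment> \<open>The convention \<open>y (- 1) = x0 = x 0\<close> removes both the discrepancy
    and the inner product at index 0.\<close>
  have V_0: "V 0 = \<eta> 0 * (norm (G x0))\<^sup>2"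
    by (simp add: V_def x_0 y_init)

  define R where "R = norm (x0 - xstar)"
  have main: "(norm (G (x k)))\<^sup>2 + 2 * L\<^sup>2 * (norm (x k - y (int k - 1)))\<^sup>2
      \<le> 4 / (\<eta>s * (real k + 1) * (real k + 2)) * (\<eta> 0 * (norm (G x0))\<^sup>2 + 1 / \<eta>s * R\<^sup>2)" for k
  proof -
    \<comment> \<open>Monotonicity against the zero \<open>xstar\<close> replaces the moving vector
      \<open>x k - x0\<close> by the fixed \<open>xstar - x0\<close>, so no bound on the iterates is
      required.\<close>
    have "0 \<le> G (x k) \<bullet> (x k - xstar)"
      using mono[of "x k" xstar] solution by simp
    then have "G (x k) \<bullet> (xstar - x0) \<le> G (x k) \<bullet> (x k - x0)"
      by (simp add: inner_simps)
    then have "(real k + 1) * (G (x k) \<bullet> (xstar - x0)) \<le> (real k + 1) * (G (x k) \<bullet> (x k - x0))"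
      by (intro mult_left_mono) auto
    then have "\<eta> k * (real k + 1) * (real k + 2) / 2 *
      ((norm (G (x k)))\<^sup>2 + L\<^sup>2 * (norm (x k - y (int k - 1)))\<^sup>2)
      + (real k + 1) * (G (x k) \<bullet> (xstar - x0)) \<le> V 0"
      using V_le[of k] unfolding V_def by linarith
    from rate_from_potential_bound[OF _ etas etas_le _ this] show ?thesis
      by (simp add: V_0 R_def norm_minus_commute mult.assoc)
  qed
  define C where "C = 4 * (\<eta> 0 * \<eta>s * L\<^sup>2 + 1) / \<eta>s\<^sup>2"
  have main_C: "(norm (G (x k)))\<^sup>2 + 2 * L\<^sup>2 * (norm (x k - y (int k - 1)))\<^sup>2
      \<le> C * R\<^sup>2 / ((real k + 1) * (real k + 2))" for k
  proof -
    \<comment> \<open>Lipschitz continuity from the zero \<open>xstar\<close> absorbs the initial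
      residual into \<open>R\<close>; the constant \<open>C\<close> collects the two resulting
      terms.\<close>
    have "norm (G x0) \<le> L * R"
      using lipschitz_onD[OF lipschitz, of x0 xstar] by (simp add: solution dist_norm R_def)
    then have "(norm (G x0))\<^sup>2 \<le> L\<^sup>2 * R\<^sup>2"
      using power_mono[of "norm (G x0)" "L * R" 2] by (simp add: power_mult_distrib)
    then have "4 / (\<eta>s * (real k + 1) * (real k + 2)) * (\<eta> 0 * (norm (G x0))\<^sup>2 + 1 / \<eta>s * R\<^sup>2)
      \<le> 4 / (\<eta>s * (real k + 1) * (real k + 2)) * (\<eta> 0 * (L\<^sup>2 * R\<^sup>2) + 1 / \<eta>s * R\<^sup>2)"
      using eta_0 etas by (intro mult_left_mono add_right_mono) auto
    also have "\<dots> = C * R\<^sup>2 / ((real k + 1) * (real k + 2))"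
      using etas by (simp add: C_def divide_simps) (simp add: algebra_simps power2_eq_square)
    finally show ?thesis using main[of k] by linarith
  qed
  have G_rate: "(norm (G (x k)))\<^sup>2 \<le> C * R\<^sup>2 / ((real k + 1) * (real k + 2))" for k
    using main_C[of k] by (smt (verit) mult_nonneg_nonneg zero_le_power2)
  have xy_rate: "(norm (x k - y (int k - 1)))\<^sup>2 \<le> C * R\<^sup>2 / (2 * L\<^sup>2 * (real k + 1) * (real k + 2))" for k
  proof -
    have "2 * L\<^sup>2 * (norm (x k - y (int k - 1)))\<^sup>2 \<le> C * R\<^sup>2 / ((real k + 1) * (real k + 2))"
      using main_C[of k] by (smt (verit) zero_le_power2)
    then have "(norm (x k - y (int k - 1)))\<^sup>2 \<le> C * R\<^sup>2 / ((real k + 1) * (real k + 2)) / (2 * L\<^sup>2)"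
      using L_pos by (subst pos_le_divide_eq) (auto simp: mult.commute)
    then show ?thesis by (simp add: mult_ac)
  qed
  have xy_rate': "(norm (x (Suc k) - y (int k)))\<^sup>2 \<le> C * R\<^sup>2 / (2 * L\<^sup>2 * (real k + 2) * (real k + 3))" for k
    using xy_rate[of "Suc k"] by (simp add: add.commute)
  have GG_rate: "(norm (G (y (int k)) - G (y (int k - 1))))\<^sup>2
      \<le> C * R\<^sup>2 / (2 * L\<^sup>2 * \<eta>s\<^sup>2 * (real k + 2) * (real k + 3))" for k
  proof -
    \<comment> \<open>The two updates differ only in the argument of \<open>G\<close>, so the
      discrepancy at index \<open>k + 1\<close> is \<open>\<eta> k\<close> times the difference
      sought. The shift gives \<open>(k + 2) * (k + 3)\<close>, and
      \<open>\<eta>s \<le> \<eta> k\<close> gives the division by \<open>\<eta>s^2\<close>.\<close>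
    have "x (Suc k) - y (int k) = (\<beta> k *\<^sub>R x0 + (1 - \<beta> k) *\<^sub>R x k - \<eta> k *\<^sub>R G (y (int k)))
        - (\<beta> k *\<^sub>R x0 + (1 - \<beta> k) *\<^sub>R x k - \<eta> k *\<^sub>R G (y (int k - 1)))"
      by (rule arg_cong2[where f = "(-)", OF x_step y_step])
    also have "\<dots> = \<eta> k *\<^sub>R (G (y (int k - 1)) - G (y (int k)))"
      by (simp add: scaleR_diff_right)
    finally have "(norm (x (Suc k) - y (int k)))\<^sup>2 = (\<eta> k)\<^sup>2 * (norm (G (y (int k)) - G (y (int k - 1))))\<^sup>2"
      by (simp add: power_mult_distrib norm_minus_commute)
    moreover have "\<eta>s\<^sup>2 * (norm (G (y (int k)) - G (y (int k - 1))))\<^sup>2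
        \<le> (\<eta> k)\<^sup>2 * (norm (G (y (int k)) - G (y (int k - 1))))\<^sup>2"
      using etas etas_le[of k] by (intro mult_right_mono power_mono) auto
    ultimately have "\<eta>s\<^sup>2 * (norm (G (y (int k)) - G (y (int k - 1))))\<^sup>2
        \<le> C * R\<^sup>2 / (2 * L\<^sup>2 * (real k + 2) * (real k + 3))"
      using xy_rate'[of k] by linarith
    then have "(norm (G (y (int k)) - G (y (int k - 1))))\<^sup>2
        \<le> C * R\<^sup>2 / (2 * L\<^sup>2 * (real k + 2) * (real k + 3)) / \<eta>s\<^sup>2"
      using etas by (subst pos_le_divide_eq) (auto simp: mult.commute)
    then show ?thesis by (simp add: mult_ac)
  qed
  \<comment> \<open>The shifted denominator is weakened to the form that
    \<open>rate_from_square_bound\<close> expects.\<close>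
  have xy_rate'': "(norm (x (Suc k) - y (int k)))\<^sup>2 \<le> C * R\<^sup>2 / (2 * L\<^sup>2) / ((real k + 1) * (real k + 2))" for k
  proof -
    have C: "0 \<le> C * R\<^sup>2 / (2 * L\<^sup>2)"
      using eta_0 etas by (auto simp: C_def)
    have "(norm (x (Suc k) - y (int k)))\<^sup>2 \<le> C * R\<^sup>2 / (2 * L\<^sup>2) / ((real k + 2) * (real k + 3))"
      using xy_rate'[of k] by (simp add: mult.assoc)
    also have "\<dots> \<le> C * R\<^sup>2 / (2 * L\<^sup>2) / ((real k + 1) * (real k + 2))"
      using C by (intro divide_left_mono mult_mono mult_pos_pos) auto
    finally show ?thesis .
  qed
  show ?thesis
    using lim lower lower_pos main G_rate xy_rate GG_rate
      rate_from_square_bound[OF G_rate] rate_from_square_bound[OF xy_rate'']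
    unfolding Let_def C_def R_def by blast
qed

end
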